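(* Let $p,m$ be positive integers and let $0\le a\le b$ be integers. Suppose the game is $(p,m)$-Imitation Nim and that $(a,b)$ is the current position, reached through some given (legal) course of play. Then $(a,b)$ is $P$ (with respect to this course of play) if and only if (I) $(a,b)\in\mathcal{P}_{W_{p,m}}$ and $0\le \xi(a,b)\le L(a,b)$, or (II) there is an integer $c$ with $a\le c<b$ such that $(a,c)\in\mathcal{P}_{W_{p,m}}$ but $-1\le L(a,c)<\xi(a,c)\le p-1$.
   Context: Positions are pairs $(a,b)$ of non-negative integers, the heights of two piles of tokens. Two players alternate; a player unable to move loses (normal play). All games are symmetric in the two piles, so $(a,b)$ and $(b,a)$ are identified when speaking of $P$/$N$. **2-pile Nim.** A move removes a positive number of tokens from exactly one pile. **$m$-imitation.** Let $A$ and $B$ be the two piles, with $\#A\le \#B$, where the tokens are counted before the previous player's removal (if the piles have equal height, either one may play the role of $A$). If the previous player removed $x>0$ tokens from pile $A$, then the next player $m$-imitates the previous player's move if he removes $y\in\{x,x+1,\dots,x+m-1\}$ tokens from pile $B$. No other move is an $m$-imitation. In particular, the first move of a game is not an $m$-imitation, nor is a move following a removal from the strictly larger pile. **$(p,m)$-Imitation Nim.** Move as in 2-pile Nim, except that no player may make $p$ consecutive $m$-imitations (i.e. $m$-imitations on $p$ consecutive moves of his own). Whether a move is allowed depends on the history of play. A position, together with the course of play leading to it (which may be empty, if it is the starting position), is $P$ if the previous player (the one not about to move) wins given best play, and $N$ if the player about to move wins given best play. **$(p,m)$-Wythoff Nim $W_{p,m}$.** From a position, a move removes either a positive number of tokens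 from exactly one pile, or $x>0$ tokens from one pile and $y>0$ tokens from the other with $|x-y|<m$. Before the next player moves from $(a,b)$, the previous player may announce at most $p-1$ positions $(a_i,b_i)$ with $b_i-a_i=b-a$, to which the next player may not move; once the next player has moved, this blocking is forgotten. A player with no available move loses. $\mathcal{P}_{W_{p,m}}$ is the set of $P$-positions of this game (positions from which the previous player wins with best play, including best blocking). **$\xi$.** For non-negative integers $a,b$, $$\xi(a,b)=\#\{(i,j)\in\mathcal{P}_{W_{p,m}} \mid j-i=b-a,\ i<a\}.$$ **$L$.** For a position $(a,b)$ in a play of $(p,m)$-Imitation Nim, $L(a,b)=p-1$ if (A) $(a,b)$ is the starting position, or (B) the most recent move was $(c,d)\to(a,b)$ where $(c,d)$ was the starting position, or (C) the last two moves were $(e,f)\to(c,d)\to(a,b)$ and $(c,d)\to(a,b)$ is not an $m$-imitation (of $(e,f)\to(c,d)$). Otherwise, with last two moves $(e,f)\to(c,d)\to(a,b)$ as in (C), $L(a,b)=L(e,f)-1$. The same definition is used for the position resulting from a hypothetical 2-pile Nim move from the current position, even if that move is prohibited by the imitation rule; thus always $-1\le L<p$, a move being prohibited exactly when the resulting value of $L$ is $-1$. In (I), $L(a,b)$ is the value for the current position with its actual history; in (II), $L(a,c)$ is the value after the (possibly prohibited) continuation $(a,b)\to(a,c)$ of the given course of play, removing $b-c$ tokens from the pile of height $b$. *)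

theory Defs
  imports Main
begin

text \<open>
  Heights of the first and of the second pile.  The pairs are ordered, because a move that follows
  up on another one has to tell the two piles apart.
\<close>
type_synonym position = "nat \<times> nat"

text \<open>
  Outcomes under normal play, for an arbitrary move relation.  A player without a move loses:
  the premise of \<open>prev_wins\<close> is then vacuous.  The least fixed point means that a win
  has to be achieved in finitely many moves.
\<close>
inductive prev_wins :: "('s \<Rightarrow> 's \<Rightarrow> bool) \<Rightarrow> 's \<Rightarrow> bool"
  and next_wins :: "('s \<Rightarrow> 's \<Rightarrow> bool) \<Rightarrow> 's \<Rightarrow> bool"
  for mv :: "'s \<Rightarrow> 's \<Rightarrow> bool"
where
  prev_winsI: "(\<And>t. mv s t \<Longrightarrow> next_wins mv t) \<Longrightarrow> prev_wins mv s"
| next_winsI: "mv s t \<Longrightarrow> prev_wins mv t \<Longrightarrow> next_wins mv s"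

fun nim_move :: "position \<Rightarrow> position \<Rightarrow> bool" where
  "nim_move (a, b) (c, d) \<longleftrightarrow> c < a \<and> d = b \<or> c = a \<and> d < b"

text \<open>
  \<open>imitation m r s t\<close>: after the opponent's move from \<open>r\<close> to \<open>s\<close>, the move from \<open>s\<close> to \<open>t\<close>
  is an \<open>m\<close>-imitation.  The two disjuncts are the two ways of assigning the roles \<open>A\<close> and \<open>B\<close>
  to the piles; both are possible at the outset if the heights in \<open>r\<close> agree.
\<close>
fun imitation :: "nat \<Rightarrow> position \<Rightarrow> position \<Rightarrow> position \<Rightarrow> bool" where
  "imitation m (e, f) (c, d) (a, b) \<longleftrightarrow>
     e \<le> f \<and> c < e \<and> d = f \<and> a = c \<and> b < d \<and> d - b \<in> {e - c ..< e - c + m} \<or>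
     f \<le> e \<and> d < f \<and> c = e \<and> b = d \<and> a < c \<and> c - a \<in> {f - d ..< f - d + m}"

text \<open>
  A course of play is the list of all positions visited, the current position first and the
  starting position last.  The moves into \<open>h ! k\<close>, \<open>h ! (k + 2)\<close>, \<open>h ! (k + 4)\<close>, \<dots>
  are those of one player.
\<close>
definition imitates_at :: "nat \<Rightarrow> position list \<Rightarrow> nat \<Rightarrow> bool" where
  "imitates_at m h k \<longleftrightarrow>
     k + 2 < length h \<and> imitation m (h ! (k + 2)) (h ! (k + 1)) (h ! k)"

definition legal_play :: "nat \<Rightarrow> nat \<Rightarrow> position list \<Rightarrow> bool" where
  "legal_play p m h \<longleftrightarrow>
     h \<noteq> [] \<and>
     (\<forall>k. k + 1 < length h \<longrightarrow> nim_move (h ! (k + 1)) (h ! k)) \<and>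
     \<not> (\<exists>k. \<forall>j<p. imitates_at m h (k + 2 * j))"

text \<open>
  Since legality depends on the history, the states of the game are the courses of play.
\<close>
definition imitation_nim_move :: "nat \<Rightarrow> nat \<Rightarrow> position list \<Rightarrow> position list \<Rightarrow> bool" where
  "imitation_nim_move p m h h' \<longleftrightarrow> (\<exists>t. h' = t # h) \<and> legal_play p m h'"

definition imitation_nim_P :: "nat \<Rightarrow> nat \<Rightarrow> position list \<Rightarrow> bool" where
  "imitation_nim_P p m h \<longleftrightarrow> prev_wins (imitation_nim_move p m) h"

text \<open>
  The second equation covers exactly the plays with at most one move.
\<close>
fun L_value :: "nat \<Rightarrow> nat \<Rightarrow> position list \<Rightarrow> int" where
  "L_value p m (t # s # r # h) =
     (if imitation m r s t then L_value p m (r # h) - 1 else int p - 1)"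
| "L_value p m h = int p - 1"

fun wythoff_option :: "nat \<Rightarrow> position \<Rightarrow> position \<Rightarrow> bool" where
  "wythoff_option m (a, b) (c, d) \<longleftrightarrow>
     c < a \<and> d = b \<or> c = a \<and> d < b \<or>
     c < a \<and> d < b \<and> \<bar>int (a - c) - int (b - d)\<bar> < int m"

text \<open>
  The difference is signed and the pairs are ordered: blocking \<open>(i, j)\<close> does not block \<open>(j, i)\<close>.
  Identifying the two here would change the set of \<open>P\<close>-positions.
\<close>
fun admissible_block :: "nat \<Rightarrow> position \<Rightarrow> position set \<Rightarrow> bool" where
  "admissible_block p (a, b) S \<longleftrightarrow>
     finite S \<and> card S \<le> p - 1 \<and> (\<forall>(i, j)\<in>S. int j - int i = int b - int a)"

text \<open>
  A state consists of the current position and of the set of positions which the previous player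
  has just blocked.  A move is followed by the mover's own announcement for the
  new position, at which point he is the previous player.
\<close>
fun wythoff_move :: "nat \<Rightarrow> nat \<Rightarrow> position \<times> position set \<Rightarrow> position \<times> position set \<Rightarrow> bool" where
  "wythoff_move p m (s, S) (t, T) \<longleftrightarrow>
     wythoff_option m s t \<and> t \<notin> S \<and> admissible_block p t T"

definition wythoff_P :: "nat \<Rightarrow> nat \<Rightarrow> position set" where
  "wythoff_P p m =
     {s. \<exists>S. admissible_block p s S \<and> prev_wins (wythoff_move p m) (s, S)}"

definition xi :: "nat \<Rightarrow> nat \<Rightarrow> position \<Rightarrow> nat" where
  "xi p m = (\<lambda>(a, b).
     card {(i, j). (i, j) \<in> wythoff_P p m \<and> int j - int i = int b - int a \<and> i < a})"

end

theory Submission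
  imports Defs
begin

text \<open>
  The winning strategy is to play Imitation Nim as if it were Wythoff Nim: one tries to leave the
  opponent on a Wythoff \<open>P\<close>-position.  A diagonal move of Wythoff Nim takes two plies of Imitation Nim,
  as one player removes from the smaller pile and the other one imitates him on the larger pile.
  So a player who has moved to a \<open>P\<close>-position, and whose opponent then lowers the smaller pile, may need
  an imitation in order to get back to a \<open>P\<close>-position.  The new \<open>P\<close>-position is then an option of the
  old one in Wythoff Nim, hence lies on the same diagonal.  The player has thereby lost one unit of \<open>L\<close>, and
  \<open>\<xi>\<close> has dropped by at least one.  If \<open>\<xi> \<le> L\<close> at the outset, he can keep responding in this way.
  If \<open>L < \<xi>\<close>, then the \<open>P\<close>-position is poisoned for the player who moves there: the opponent can force him
  to imitate from each \<open>P\<close>-position of the diagonal to the preceding one, until he has no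
  imitation left.  Alternative (II) of the theorem says that the \<open>P\<close>-position to the left in
  the row is poisoned for the player about to move.

  Call a play good if it satisfies (I) or (II).  Since every play terminates, it is enough that no
  move leads from a good play to a good one (\<open>not_good_after_good\<close>) and that from every other
  play some legal move leads to a good one (\<open>good_move_if_not_good\<close>).  Both use the shape of
  the set of Wythoff \<open>P\<close>-positions: two of them never lie in one row, and if one is an option
  of another then both lie on the same diagonal.  Two less immediate facts are needed, about
  \<open>P\<close>-positions \<open>(i, i + k)\<close> above the main diagonal.  The offset \<open>k\<close> grows weakly with \<open>i\<close>
  (\<open>wythoff_P_offset_mono\<close>), which prevents a player from escaping a poisoned row by lowering the
  smaller pile.  Further, a position \<open>(a, b)\<close> with \<open>a \<le> b\<close> that is neither a \<open>P\<close>-position nor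
  has one to its left in its row always has as a Wythoff option a \<open>P\<close>-position with the maximal value \<open>\<xi> = p - 1\<close>, such that the way there
  ends in an imitation (\<open>full_band\<close>).  Imitating into it leaves \<open>L \<le> p - 2\<close>, so it is poisoned for
  the opponent, and the player may safely make the first half of that move himself.
\<close>

section \<open>Terminating games\<close>

lemma next_wins_iff_not_prev_wins:
  fixes f :: "'s \<Rightarrow> nat"
  assumes "Inv s"
    and step: "\<And>s t. Inv s \<Longrightarrow> mv s t \<Longrightarrow> Inv t \<and> f t < f s"
  shows "next_wins mv s \<longleftrightarrow> \<not> prev_wins mv s"
  using assms(1)
proof (induction "f s" arbitrary: s rule: less_induct)
  case less
  have IH: "next_wins mv t \<longleftrightarrow> \<not> prev_wins mv t" if "mv s t" for t
    using less step that by blast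
  show ?case
    by (metis IH next_wins.simps prev_wins.simps)
qed

lemma prev_wins_iff_kernel:
  fixes f :: "'s \<Rightarrow> nat"
  assumes "Inv s"
    and step: "\<And>s t. Inv s \<Longrightarrow> mv s t \<Longrightarrow> Inv t \<and> f t < f s"
    and stable: "\<And>s t. Inv s \<Longrightarrow> K s \<Longrightarrow> mv s t \<Longrightarrow> \<not> K t"
    and absorbing: "\<And>s. Inv s \<Longrightarrow> \<not> K s \<Longrightarrow> \<exists>t. mv s t \<and> K t"
  shows "prev_wins mv s \<longleftrightarrow> K s"
  using assms(1)
proof (induction "f s" arbitrary: s rule: less_induct)
  case less
  have IH: "prev_wins mv t \<longleftrightarrow> K t" if "mv s t" for t
    using less step that by blast
  have "prev_wins mv s \<longleftrightarrow> (\<forall>t. mv s t \<longrightarrow> \<not> prev_wins mv t)"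
    using next_wins_iff_not_prev_wins[of Inv _ mv f] step less.prems
    by (metis prev_wins.simps)
  then show ?case
    using IH stable absorbing less.prems by blast
qed

section \<open>Counting along a diagonal\<close>

lemma finite_diagonal_below:
  "finite {(i, j). (i, j) \<in> A \<and> int j - int i = int b - int a \<and> i < a}"
  by (rule finite_subset[of _ "{..<a} \<times> {..<b}"]) auto

lemma xi_less:
  assumes "(i, j) \<in> wythoff_P p m" "int j - int i = int b - int a" "i < a"
  shows "xi p m (i, j) < xi p m (a, b)"
  unfolding xi_def prod.case
  by (rule psubset_card_mono[OF finite_diagonal_below]) (use assms in auto)

lemma xi_Suc:
  "xi p m (Suc a, Suc b) = xi p m (a, b) + (if (a, b) \<in> wythoff_P p m then 1 else 0)"
proof -
  let ?D = "\<lambda>a b. {(i, j). (i, j) \<in> wythoff_P p m \<and> int j - int i = int b - int a \<and> i < a}"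
  have "?D (Suc a) (Suc b) = (if (a, b) \<in> wythoff_P p m then insert (a, b) (?D a b) else ?D a b)"
    by (auto simp: less_Suc_eq)
  moreover have "(a, b) \<notin> ?D a b"
    by simp
  ultimately show ?thesis
    using finite_diagonal_below[of "wythoff_P p m" b a] by (simp add: xi_def)
qed

text \<open>
  The value \<open>\<xi>\<close> numbers the \<open>P\<close>-positions of a diagonal consecutively from \<open>0\<close>.
\<close>
lemma xi_level:
  assumes "k < xi p m (a, b)"
  obtains i j where "(i, j) \<in> wythoff_P p m" "int j - int i = int b - int a" "i < a"
    "xi p m (i, j) = k"
proof -
  have "\<exists>i j. (i, j) \<in> wythoff_P p m \<and> int j - int i = int b - int a \<and> i < a \<and> xi p m (i, j) = k"
    using assms
  proof (induction a arbitrary: b)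
    case 0
    then show ?case by (simp add: xi_def)
  next
    case (Suc a)
    show ?case
    proof (cases b)
      case 0
      have "{(i, j). (i, j) \<in> wythoff_P p m \<and> int j - int i = int b - int (Suc a) \<and> i < Suc a} = {}"
        using 0 by auto
      then have "xi p m (Suc a, b) = 0"
        unfolding xi_def prod.case by (simp only: card.empty)
      then show ?thesis using Suc.prems by simp
    next
      case (Suc b')
      show ?thesis
      proof (cases "k < xi p m (a, b')")
        case True
        from Suc.IH[OF this] show ?thesis using Suc by force
      next
        case False
        then have "(a, b') \<in> wythoff_P p m \<and> xi p m (a, b') = k"
          using Suc.prems Suc xi_Suc[of p m a b'] by (auto split: if_splits)
        then show ?thesis using Suc by force
      qed
    qed
  qed
  then show thesis using that by blast
qed

section \<open>Legality and the number of remaining imitations\<close>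

lemma L_value_le: "L_value p m H \<le> int p - 1"
  by (induction p m H rule: L_value.induct) auto

text \<open>
  \<open>L\<close> falls short of \<open>p - 1\<close> by the length of the run of consecutive imitations with which the
  player who has just moved ends the play.
\<close>
lemma L_value_run:
  "int n \<le> int p - 1 - L_value p m H \<longleftrightarrow> (\<forall>j<n. imitates_at m H (2 * j))"
proof (induction p m H arbitrary: n rule: L_value.induct)
  case (1 p m t s r h)
  have shift: "imitates_at m (t # s # r # h) (2 * Suc j) \<longleftrightarrow> imitates_at m (r # h) (2 * j)" for j
    by (simp add: imitates_at_def)
  have first: "imitates_at m (t # s # r # h) 0 \<longleftrightarrow> imitation m r s t"
    by (simp add: imitates_at_def)
  show ?case
  proof (cases n)
    case 0
    then show ?thesis using L_value_le[of p m "t # s # r # h"] by simp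
  next
    case (Suc n')
    have "(\<forall>j<n. imitates_at m (t # s # r # h) (2 * j)) \<longleftrightarrow>
        imitation m r s t \<and> (\<forall>j<n'. imitates_at m (r # h) (2 * j))"
      unfolding Suc All_less_Suc2 shift using first by simp
    then show ?thesis
      using 1[of n'] Suc by auto
  qed
qed (auto simp: imitates_at_def)

text \<open>
  A new move can only complete a run of imitations that ends with it, so one needs to watch nothing
  but the new value of \<open>L\<close>.
\<close>
lemma legal_play_Cons:
  assumes "H \<noteq> []"
  shows "legal_play p m (t # H) \<longleftrightarrow>
    legal_play p m H \<and> nim_move (hd H) t \<and> 0 \<le> L_value p m (t # H)"
proof -
  have moves: "(\<forall>k. k + 1 < length (t # H) \<longrightarrow> nim_move ((t # H) ! (k + 1)) ((t # H) ! k)) \<longleftrightarrow>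
      nim_move (hd H) t \<and> (\<forall>k. k + 1 < length H \<longrightarrow> nim_move (H ! (k + 1)) (H ! k))"
    (is "(\<forall>k. ?P k) \<longleftrightarrow> _")
  proof -
    have "(\<forall>k. ?P k) \<longleftrightarrow> ?P 0 \<and> (\<forall>k. ?P (Suc k))" by (metis not0_implies_Suc)
    then show ?thesis using assms by (simp add: hd_conv_nth)
  qed
  have shift: "imitates_at m (t # H) (Suc k + 2 * j) \<longleftrightarrow> imitates_at m H (k + 2 * j)" for k j
    by (simp add: imitates_at_def)
  have runs: "(\<exists>k. \<forall>j<p. imitates_at m (t # H) (k + 2 * j)) \<longleftrightarrow>
      (\<forall>j<p. imitates_at m (t # H) (2 * j)) \<or> (\<exists>k. \<forall>j<p. imitates_at m H (k + 2 * j))"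
    (is "(\<exists>k. ?Q k) \<longleftrightarrow> _")
  proof -
    have "(\<exists>k. ?Q k) \<longleftrightarrow> ?Q 0 \<or> (\<exists>k. ?Q (Suc k))" by (metis not0_implies_Suc)
    then show ?thesis using shift by simp
  qed
  have "(\<forall>j<p. imitates_at m (t # H) (2 * j)) \<longleftrightarrow> \<not> 0 \<le> L_value p m (t # H)"
    using L_value_run[of p p m "t # H"] by auto
  then show ?thesis
    unfolding legal_play_def moves runs using assms by auto
qed

lemma L_value_nonneg:
  assumes "legal_play p m H"
  shows "0 \<le> L_value p m H"
proof -
  have "\<not> (\<forall>j<p. imitates_at m H (0 + 2 * j))"
    using assms unfolding legal_play_def by blast
  then show ?thesis using L_value_run[of p p m H] by auto
qed

lemma L_value_less_imp_imitation:
  assumes "L_value p m (t # s # h) < int p - 1"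
  obtains r h' where "h = r # h'" "imitation m r s t"
  using assms that by (cases h) (auto split: if_splits)

lemma imitation_swap:
  "imitation m (prod.swap r) (prod.swap s) (prod.swap t) \<longleftrightarrow> imitation m r s t"
  by (cases r; cases s; cases t) auto

lemma nim_move_swap: "nim_move (prod.swap s) (prod.swap t) \<longleftrightarrow> nim_move s t"
  by (cases s; cases t) auto

lemma L_value_swap: "L_value p m (map prod.swap H) = L_value p m H"
  by (induction p m H rule: L_value.induct) (auto simp: imitation_swap)

lemma legal_play_swap: "legal_play p m (map prod.swap H) \<longleftrightarrow> legal_play p m H"
proof -
  have imitates: "imitates_at m (map prod.swap H) k \<longleftrightarrow> imitates_at m H k" for k
    by (auto simp: imitates_at_def imitation_swap)
  show ?thesis
    unfolding legal_play_def imitates by (auto simp: nim_move_swap)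
qed

lemma wythoff_option_if_imitation: "imitation m r s t \<Longrightarrow> wythoff_option m r t"
  by (cases r; cases s; cases t) auto

text \<open>
  At the time of an imitation, the pile it reduces is strictly higher than the other one, because the
  opponent has just lowered a pile that was not the higher one.
\<close>
lemma no_imitation_on_smaller_pile:
  assumes "a' < a" "a \<le> b"
  shows "\<not> imitation m r (a, b) (a', b)"
  using assms by (cases r) auto

section \<open>The P-positions of Wythoff Nim with blocking\<close>

locale pile_games =
  fixes p m :: nat
  assumes p_pos: "p \<ge> 1" and m_pos: "m \<ge> 1"
begin

abbreviation W :: "position set" where "W \<equiv> wythoff_P p m"

lemma wythoff_P_iff_blocking:
  "s \<in> W \<longleftrightarrow> (\<exists>S. admissible_block p s S \<and> (\<forall>t\<in>W. wythoff_option m s t \<longrightarrow> t \<in> S))"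
proof -
  define f where "f = (\<lambda>((a, b), S :: position set). a + b :: nat)"
  have step: "True \<and> f t < f s" if "wythoff_move p m s t" for s t
    using that by (cases s; cases t) (auto simp: f_def)
  have det: "next_wins (wythoff_move p m) s \<longleftrightarrow> \<not> prev_wins (wythoff_move p m) s" for s
    using next_wins_iff_not_prev_wins[of "\<lambda>_. True" s "wythoff_move p m" f] step by blast
  have "prev_wins (wythoff_move p m) (s, S) \<longleftrightarrow> (\<forall>t\<in>W. wythoff_option m s t \<longrightarrow> t \<in> S)" for S
  proof -
    have "prev_wins (wythoff_move p m) (s, S) \<longleftrightarrow>
      (\<forall>x. wythoff_move p m (s, S) x \<longrightarrow> \<not> prev_wins (wythoff_move p m) x)"
      by (metis det prev_wins.simps)
    then show ?thesis
      by (auto simp: wythoff_P_def)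
  qed
  then show ?thesis
    by (simp add: wythoff_P_def)
qed

text \<open>
  The most effective announcement blocks the \<open>P\<close>-positions below on the diagonal.  It suffices
  exactly if there are fewer than \<open>p\<close> of them and no option off the diagonal is a \<open>P\<close>-position.
\<close>
lemma wythoff_P_iff:
  "(a, b) \<in> W \<longleftrightarrow>
    (\<forall>i j. (i, j) \<in> W \<and> wythoff_option m (a, b) (i, j) \<longrightarrow> int j - int i = int b - int a) \<and>
    xi p m (a, b) < p"
proof -
  let ?D = "{(i, j). (i, j) \<in> W \<and> int j - int i = int b - int a \<and> i < a}"
  have D_option: "wythoff_option m (a, b) t" if "t \<in> ?D" for t
    using that m_pos by auto
  have option_D: "(i, j) \<in> ?D"
    if "(i, j) \<in> W" "wythoff_option m (a, b) (i, j)" "int j - int i = int b - int a" for i j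
    using that by auto
  show ?thesis
  proof
    assume "(a, b) \<in> W"
    then obtain S where S: "admissible_block p (a, b) S"
      "\<forall>t\<in>W. wythoff_option m (a, b) t \<longrightarrow> t \<in> S"
      using wythoff_P_iff_blocking by blast
    have "?D \<subseteq> S" using S(2) D_option by blast
    moreover have "finite S" "card S \<le> p - 1" using S(1) by auto
    ultimately have "card ?D \<le> p - 1" by (meson card_mono le_trans)
    then have "xi p m (a, b) < p"
      using p_pos unfolding xi_def prod.case by linarith
    then show "(\<forall>i j. (i, j) \<in> W \<and> wythoff_option m (a, b) (i, j) \<longrightarrow>
        int j - int i = int b - int a) \<and> xi p m (a, b) < p"
      using S unfolding admissible_block.simps by blast
  next
    assume *: "(\<forall>i j. (i, j) \<in> W \<and> wythoff_option m (a, b) (i, j) \<longrightarrow>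
        int j - int i = int b - int a) \<and> xi p m (a, b) < p"
    have "card ?D \<le> p - 1"
      using * unfolding xi_def prod.case by linarith
    then have "admissible_block p (a, b) ?D"
      using finite_diagonal_below[of W b a] unfolding admissible_block.simps by blast
    moreover have "\<forall>t\<in>W. wythoff_option m (a, b) t \<longrightarrow> t \<in> ?D"
    proof (intro ballI impI)
      fix t assume "t \<in> W" "wythoff_option m (a, b) t"
      moreover obtain i j where "t = (i, j)" by (cases t)
      ultimately show "t \<in> ?D" using * option_D by blast
    qed
    ultimately show "(a, b) \<in> W"
      using wythoff_P_iff_blocking by blast
  qed
qed

lemma xi_lt_p: "s \<in> W \<Longrightarrow> xi p m s < p"
  using wythoff_P_iff[of "fst s" "snd s"] by simp

lemma wythoff_P_option_diagonal:
  assumes "(a, b) \<in> W" "(i, j) \<in> W" "wythoff_option m (a, b) (i, j)"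
  shows "int j - int i = int b - int a"
  using assms wythoff_P_iff[of a b] by blast

lemma no_nim_move_within_wythoff_P:
  assumes "s \<in> W" "t \<in> W"
  shows "\<not> nim_move s t"
proof
  assume nim: "nim_move s t"
  obtain a b i j where st: "s = (a, b)" "t = (i, j)" by (cases s; cases t)
  have "wythoff_option m (a, b) (i, j)"
    using nim st by auto
  with assms st have "int j - int i = int b - int a"
    using wythoff_P_option_diagonal by blast
  then show False
    using nim st by auto
qed

lemma wythoff_P_row_unique: "(a, c) \<in> W \<Longrightarrow> (a, d) \<in> W \<Longrightarrow> c = d"
  using no_nim_move_within_wythoff_P[of "(a, c)" "(a, d)"]
    no_nim_move_within_wythoff_P[of "(a, d)" "(a, c)"] by (cases c d rule: linorder_cases) auto

lemma no_wythoff_P_left_in_row: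
  assumes "(i, i + k) \<in> W" "d < k"
  shows "\<forall>c\<le>i + d. (i, c) \<notin> W"
proof (intro allI impI notI)
  fix c assume "c \<le> i + d" "(i, c) \<in> W"
  then show False
    using wythoff_P_row_unique[OF assms(1), of c] assms(2) by linarith
qed

lemma zero_in_wythoff_P: "(0, 0) \<in> W"
  using p_pos by (subst wythoff_P_iff) (auto simp: xi_def)

text \<open>
  Off the main diagonal but closer to it than \<open>m\<close>, the position \<open>(0, 0)\<close> is an option that cannot be blocked.
\<close>
lemma wythoff_P_near_main_diagonal:
  assumes "(a, b) \<in> W" "\<bar>int a - int b\<bar> < int m"
  shows "a = b"
proof (rule ccontr)
  assume "a \<noteq> b"
  then have "wythoff_option m (a, b) (0, 0)"
    using assms(2) by auto
  from wythoff_P_option_diagonal[OF assms(1) zero_in_wythoff_P this] \<open>a \<noteq> b\<close> show False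
    by simp
qed

lemma wythoff_P_swap: "prod.swap s \<in> W \<longleftrightarrow> s \<in> W"
proof -
  have imp: "s \<in> W \<Longrightarrow> prod.swap s \<in> W" for s
  proof (induction "fst s + snd s" arbitrary: s rule: less_induct)
    case less
    obtain S where S: "admissible_block p s S" "\<forall>t\<in>W. wythoff_option m s t \<longrightarrow> t \<in> S"
      using less.prems wythoff_P_iff_blocking by blast
    have "admissible_block p (prod.swap s) (prod.swap ` S)"
    proof -
      obtain a b where s: "s = (a, b)" by (cases s)
      have "finite S" "card S \<le> p - 1" "\<forall>(i, j)\<in>S. int j - int i = int b - int a"
        using S(1) s by auto
      moreover from this have "card (prod.swap ` S) \<le> p - 1"
        using card_image_le order_trans by blast
      ultimately show ?thesis using s by fastforce
    qed
    moreover have "t \<in> prod.swap ` S" if t: "t \<in> W" "wythoff_option m (prod.swap s) t" for t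
    proof -
      have "wythoff_option m s (prod.swap t)"
        using t(2) by (cases s; cases t) auto
      moreover have "prod.swap t \<in> W"
        using t less.hyps[of t] by (cases s; cases t) auto
      ultimately have "prod.swap t \<in> S" using S(2) by blast
      then show ?thesis by (metis image_eqI swap_swap)
    qed
    ultimately show ?case using wythoff_P_iff_blocking by blast
  qed
  show ?thesis using imp[of s] imp[of "prod.swap s"] by auto
qed

lemma xi_swap: "xi p m (prod.swap s) = xi p m s"
proof (cases s)
  case (Pair a b)
  let ?D = "\<lambda>a b. {(i, j). (i, j) \<in> W \<and> int j - int i = int b - int a \<and> i < a}"
  have "?D b a = prod.swap ` ?D a b"
  proof -
    have "(i, j) \<in> W \<longleftrightarrow> (j, i) \<in> W" for i j
      using wythoff_P_swap[of "(i, j)"] by simp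
    then show ?thesis by (auto simp: image_iff)
  qed
  then have "card (?D b a) = card (?D a b)"
    by (simp add: card_image)
  then show ?thesis using Pair by (simp add: xi_def)
qed

text \<open>
  Suppose \<open>d < k\<close>.  Then row \<open>i\<close> is empty up to column \<open>i + d\<close>, and \<open>full\<close> yields a \<open>P\<close>-position
  which is an option of \<open>(a, a + d)\<close>.  So it lies on the same diagonal, where it has already
  \<open>p - 1\<close> predecessors; this makes \<open>(a, a + d)\<close> a \<open>P\<close>-position too many.

  The premise \<open>full\<close> is the conclusion of \<open>full_band\<close> for row \<open>i\<close>; it is kept as a premise since the
  induction for \<open>full_band\<close> needs this monotonicity in the rows treated before.
\<close>
lemma offset_le_if_full_band:
  assumes "(a, a + d) \<in> W" "i < a" "(i, i + k) \<in> W"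
    and full: "\<forall>c\<le>i + d. (i, c) \<notin> W \<Longrightarrow>
      \<exists>i' k'. (i', i' + k') \<in> W \<and> i' < i \<and> k' \<le> d \<and> d < k' + m \<and> xi p m (i', i' + k') = p - 1"
  shows "k \<le> d"
proof (rule ccontr)
  assume "\<not> k \<le> d"
  then have "\<forall>c\<le>i + d. (i, c) \<notin> W"
    by (intro no_wythoff_P_left_in_row[OF assms(3)]) simp
  from full[OF this] obtain i' k' where *: "(i', i' + k') \<in> W" "i' < i" "k' \<le> d" "d < k' + m"
    "xi p m (i', i' + k') = p - 1" by blast
  have "wythoff_option m (a, a + d) (i', i' + k')"
    using * assms(2) by auto
  from wythoff_P_option_diagonal[OF assms(1) *(1) this] have "k' = d" by simp
  then have "xi p m (i', i' + k') < xi p m (a, a + d)"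
    using * assms(2) by (intro xi_less) auto
  then show False
    using *(5) xi_lt_p[OF assms(1)] by simp
qed

text \<open>
  The diagonals at distance \<open>0, m, 2 m, \<dots>\<close> from the main one are filled one after the other, each with
  \<open>p\<close> of the \<open>P\<close>-positions \<open>(i, j)\<close> with \<open>i \<le> j\<close>.  A row that has no \<open>P\<close>-position up to offset \<open>d\<close> has hence been
  reached only after the last of these diagonals with offset at most \<open>d\<close> was full.  The induction
  on row and offset avoids computing the \<open>P\<close>-positions: it asks why \<open>(a, a + d)\<close> is not one of them.
\<close>
lemma full_band:
  assumes "\<forall>c\<le>a + d. (a, c) \<notin> W"
  shows "\<exists>i k. (i, i + k) \<in> W \<and> i < a \<and> k \<le> d \<and> d < k + m \<and> xi p m (i, i + k) = p - 1"
  using assms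
proof (induction a arbitrary: d rule: less_induct)
  case (less a)
  note outer = less.IH
  show ?case
    using less.prems
  proof (induction d rule: less_induct)
    case (less d)
    show ?case
    proof (cases "\<exists>i k. (i, i + k) \<in> W \<and> i < a \<and> d < k")
      \<comment> \<open>An earlier row has been left empty up to offset \<open>d\<close>, too; the claim holds there already.\<close>
      case True
      then obtain i k where ik: "(i, i + k) \<in> W" "i < a" "d < k" by blast
      then have "\<forall>c\<le>i + d. (i, c) \<notin> W"
        using no_wythoff_P_left_in_row by blast
      from outer[OF ik(2) this] ik(2) show ?thesis by (meson less_trans)
    next
      case low: False
      have "(a, a + d) \<notin> W" using less.prems by blast
      then have "p \<le> xi p m (a, a + d) \<or>
          (\<exists>i j. (i, j) \<in> W \<and> wythoff_option m (a, a + d) (i, j) \<and> int j - int i \<noteq> int d)"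
        unfolding wythoff_P_iff[of a "a + d"] not_le[symmetric]
        by (simp del: wythoff_option.simps) blast
      then consider
        (full) "p \<le> xi p m (a, a + d)"
        | (off) i j where "(i, j) \<in> W" "wythoff_option m (a, a + d) (i, j)" "int j - int i \<noteq> int d"
        by blast
      then show ?thesis
      proof cases
        case full
        then have "p - 1 < xi p m (a, a + d)" using p_pos by simp
        then obtain i j where ij: "(i, j) \<in> W" "int j - int i = int (a + d) - int a" "i < a"
          "xi p m (i, j) = p - 1"
          by (rule xi_level)
        have j: "j = i + d" using ij(2) by simp
        have "(i, i + d) \<in> W" "i < a" "d \<le> d" "d < d + m" "xi p m (i, i + d) = p - 1"
          using ij(1,3,4) m_pos unfolding j by simp_all
        then show ?thesis by blast
      next
        case off
        have not_row: "\<not> (i = a \<and> j < a + d)"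
          using off(1) less.prems less_imp_le by blast
        have "\<not> (i < a \<and> j = a + d)"
        proof
          assume "i < a \<and> j = a + d"
          then have "(i, i + (a + d - i)) \<in> W" "i < a" "d < a + d - i"
            using off(1) by simp_all linarith
          then show False using low by blast
        qed
        with off(2) not_row have below: "i < a" "j < a + d"
          "\<bar>int (a - i) - int (a + d - j)\<bar> < int m"
          unfolding wythoff_option.simps by blast+
        have "i \<le> j"
        proof (rule ccontr)
          assume "\<not> i \<le> j"
          then show False
            using wythoff_P_near_main_diagonal[OF off(1)] below by linarith
        qed
        then obtain k where k: "j = i + k" using le_Suc_ex by blast
        have "k \<noteq> d" using off(3) k by simp
        moreover have "k \<le> d"
          using low off(1) below(1) unfolding k by (meson not_le)
        ultimately have "k < d" by simp
        have "d < k + m" using below k by linarith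
        have "\<forall>c\<le>a + k. (a, c) \<notin> W"
          using less.prems \<open>k < d\<close> by (meson add_left_mono le_trans less_imp_le)
        from less.IH[OF \<open>k < d\<close> this] obtain i' k' where *:
          "(i', i' + k') \<in> W" "i' < a" "k' \<le> k" "k < k' + m" "xi p m (i', i' + k') = p - 1"
          by blast
        \<comment> \<open>If \<open>i' < i\<close>, then \<open>(i', i' + k')\<close> is an option of \<open>(i, j)\<close>, as the offsets differ by less
          than \<open>m\<close>.  If \<open>i < i'\<close>, the induction hypothesis for row \<open>i\<close> gives monotonicity.\<close>
        have "k' = k"
        proof (cases i i' rule: linorder_cases)
          case less
          have "(i, i + k) \<in> W" using off(1) k by simp
          then have "k \<le> k'"
            using offset_le_if_full_band[OF *(1) less] outer[OF below(1)] by blast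
          then show ?thesis using *(3) by simp
        next
          case equal
          then have "(i, i + k') \<in> W" using *(1) by simp
          then show ?thesis using wythoff_P_row_unique[OF off(1), of "i + k'"] k by simp
        next
          case greater
          then have "wythoff_option m (i, j) (i', i' + k')"
            using k * by auto
          from wythoff_P_option_diagonal[OF off(1) *(1) this] show ?thesis using k by simp
        qed
        then have "k' \<le> d" "d < k' + m"
          using \<open>k < d\<close> \<open>d < k + m\<close> by simp_all
        with * show ?thesis by blast
      qed
    qed
  qed
qed

lemma wythoff_P_offset_mono:
  assumes "(a, a + d) \<in> W" "(i, i + k) \<in> W" "i < a"
  shows "k \<le> d"
  using offset_le_if_full_band[OF assms(1,3,2)] full_band by blast

end



section \<open>Good plays of Imitation Nim\<close>

text \<open>
  For a position with heights \<open>a \<le> b\<close> these are the moves to heights \<open>a\<close> and \<open>c\<close> with \<open>a \<le> c < b\<close> which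
  alternative (II) speaks of, for either order of the piles.
\<close>
fun leveling_move :: "position \<Rightarrow> position \<Rightarrow> bool" where
  "leveling_move (a, b) (c, d) \<longleftrightarrow> c = a \<and> a \<le> d \<and> d < b \<or> d = b \<and> b \<le> c \<and> c < a"

lemma leveling_move_swap: "leveling_move (prod.swap s) (prod.swap t) \<longleftrightarrow> leveling_move s t"
  by (cases s; cases t) auto

context pile_games
begin

text \<open>
  Alternatives (I) and (II) of the theorem in a form that does not sort the heights, and is thus visibly
  invariant under exchanging the piles.
\<close>
definition good :: "position list \<Rightarrow> bool" where
  "good H \<longleftrightarrow>
     hd H \<in> W \<and> int (xi p m (hd H)) \<le> L_value p m H \<or>
     (\<exists>t\<in>W. leveling_move (hd H) t \<and> L_value p m (t # H) < int (xi p m t))"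

lemma good_swap:
  assumes "H \<noteq> []"
  shows "good (map prod.swap H) \<longleftrightarrow> good H"
proof -
  have L: "L_value p m (prod.swap t # map prod.swap H) = L_value p m (t # H)" for t
    using L_value_swap[of p m "t # H"] by simp
  have "(\<exists>t\<in>W. leveling_move (prod.swap (hd H)) t \<and>
        L_value p m (t # map prod.swap H) < int (xi p m t)) \<longleftrightarrow>
      (\<exists>t\<in>W. leveling_move (hd H) t \<and> L_value p m (t # H) < int (xi p m t))" (is "?l \<longleftrightarrow> ?r")
  proof
    assume ?l
    then obtain t where "t \<in> W" "leveling_move (prod.swap (hd H)) t"
      "L_value p m (t # map prod.swap H) < int (xi p m t)" by blast
    then show ?r
      using L[of "prod.swap t"] leveling_move_swap[of "hd H" "prod.swap t"]
        wythoff_P_swap[of t] xi_swap[of t] by (auto intro!: bexI[of _ "prod.swap t"])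
  next
    assume ?r
    then obtain t where "t \<in> W" "leveling_move (hd H) t"
      "L_value p m (t # H) < int (xi p m t)" by blast
    then show ?l
      using L[of t] leveling_move_swap[of "hd H" t]
        wythoff_P_swap[of t] xi_swap[of t] by (auto intro!: bexI[of _ "prod.swap t"])
  qed
  then show ?thesis
    unfolding good_def
    using assms by (simp add: hd_map L_value_swap wythoff_P_swap xi_swap)
qed

text \<open>
  Since \<open>\<xi> < p\<close> on \<open>P\<close>-positions, a reply that enters a poisoned \<open>P\<close>-position \<open>u\<close> would have to be an imitation.
  But then \<open>u\<close> is on the diagonal of \<open>s\<close>, and passing from \<open>s\<close> to \<open>u\<close> lowers \<open>L\<close> by one and \<open>\<xi>\<close> by at
  least one, so that \<open>u\<close> is not poisoned.
\<close>
lemma not_good_after_safe: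
  assumes "s \<in> W" "int (xi p m s) \<le> L_value p m (s # h)" "nim_move s t"
  shows "\<not> good (t # s # h)"
proof
  assume "good (t # s # h)"
  moreover have "t \<notin> W"
    using assms no_nim_move_within_wythoff_P by blast
  ultimately obtain u where u: "u \<in> W" "L_value p m (u # t # s # h) < int (xi p m u)"
    by (auto simp: good_def)
  then have "L_value p m (u # t # s # h) < int p - 1"
    using xi_lt_p[OF u(1)] by linarith
  then have im: "imitation m s t u"
    by (auto split: if_splits)
  then have L: "L_value p m (u # t # s # h) = L_value p m (s # h) - 1"
    by simp
  have "xi p m u < xi p m s"
    using wythoff_P_option_diagonal[of "fst s" "snd s" "fst u" "snd u"]
      wythoff_option_if_imitation[OF im] assms(1) u(1) im
      xi_less[of "fst u" "snd u" p m "snd s" "fst s"]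
    by (cases s; cases t; cases u) auto
  then show False using u(2) L assms(2) by linarith
qed

text \<open>
  Since \<open>L < p - 1\<close> at \<open>(a, c)\<close>, moving there would be an imitation, so the play has just come from some
  \<open>(e, b)\<close> with \<open>a < e \<le> b\<close>, and \<open>L = p - 1\<close> now.  Lowering the larger pile gains nothing, because it
  cannot be answered by an imitation.  Lowering the smaller pile does not reach a \<open>P\<close>-position, by
  monotonicity of the offsets.  It may permit an imitation into a \<open>P\<close>-position, with \<open>L = p - 2\<close>
  afterwards; but this one is on the diagonal of \<open>(a, c)\<close> and before it, so \<open>\<xi> \<le> p - 2\<close> there and it is not
  poisoned.
\<close>
lemma not_good_after_trap:
  assumes "(a, c) \<in> W" "a \<le> c" "c < b"
    and trap: "L_value p m ((a, c) # (a, b) # h) < int (xi p m (a, c))"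
    and "nim_move (a, b) t"
  shows "\<not> good (t # (a, b) # h)"
proof
  assume good: "good (t # (a, b) # h)"
  have "L_value p m ((a, c) # (a, b) # h) < int p - 1"
    using trap xi_lt_p[OF assms(1)] by linarith
  then obtain r h' where h: "h = r # h'" and im: "imitation m r (a, b) (a, c)"
    by (rule L_value_less_imp_imitation)
  obtain e where r: "r = (e, b)" "a < e" "e \<le> b"
    using im assms(2,3) by (cases r) auto
  have L_here: "L_value p m ((a, b) # h) = int p - 1"
    using h r no_imitation_on_smaller_pile[of a e b m] by (cases h') auto
  from good consider
    (safe) "t \<in> W" "int (xi p m t) \<le> L_value p m (t # (a, b) # h)"
    | (trap) u where "u \<in> W" "leveling_move t u" "L_value p m (u # t # (a, b) # h) < int (xi p m u)"
    by (auto simp: good_def)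
  then show False
  proof cases
    case safe
    from assms(5) consider d where "t = (a, d)" | a' where "a' < a" "t = (a', b)"
      by (cases t) auto
    then show False
    proof cases
      case 1
      then have "t = (a, c)" using safe(1) wythoff_P_row_unique[OF assms(1)] by simp
      then show False using safe(2) trap by simp
    next
      case 2
      then have "b - a' \<le> c - a"
        using safe(1) assms(1-3) wythoff_P_offset_mono[of a "c - a" a' "b - a'"] by simp
      then show False using 2 assms(2,3) by linarith
    qed
  next
    case trap
    have "L_value p m (u # t # (a, b) # h) < int p - 1"
      using trap(3) xi_lt_p[OF trap(1)] by linarith
    then have im: "imitation m (a, b) t u"
      by (auto split: if_splits)
    then have L: "L_value p m (u # t # (a, b) # h) = int p - 2"
      using L_here by simp
    obtain a' e' where u: "t = (a', b)" "u = (a', e')" "a' < a" "e' < b"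
      "b - e' \<in> {a - a' ..< a - a' + m}"
      using im assms(2,3) by (cases t; cases u) auto
    have "a' \<le> e'" using trap(2) u by auto
    then have offset: "e' - a' \<le> c - a"
      using wythoff_P_offset_mono[of a "c - a" a' "e' - a'"] trap(1) u assms(1,2) by simp
    then have "wythoff_option m (a, c) (a', e')"
      using u assms(2,3) \<open>a' \<le> e'\<close> by auto
    then have "int e' - int a' = int c - int a"
      using wythoff_P_option_diagonal assms(1) trap(1) u by blast
    then have "xi p m u < xi p m (a, c)"
      using xi_less trap(1) u by blast
    then show False
      using xi_lt_p[OF assms(1)] trap(3) L by linarith
  qed
qed

lemma not_good_after_good:
  assumes "good (s # h)" "nim_move s t"
  shows "\<not> good (t # s # h)"
proof -
  consider (safe) "s \<in> W" "int (xi p m s) \<le> L_value p m (s # h)"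
    | (trap) u where "u \<in> W" "leveling_move s u" "L_value p m (u # s # h) < int (xi p m u)"
    using assms(1) by (auto simp: good_def)
  then show ?thesis
  proof cases
    case safe
    then show ?thesis using not_good_after_safe assms(2) by blast
  next
    case trap
    obtain a b where s: "s = (a, b)" by (cases s)
    obtain a' b' where u: "u = (a', b')" by (cases u)
    show ?thesis
    proof (cases "a' = a \<and> a \<le> b' \<and> b' < b")
      case True
      then show ?thesis using not_good_after_trap[of a b' b h t] trap assms(2) s u by simp
    next
      case False
      then have *: "b' = b" "b \<le> a'" "a' < a" using trap(2) s u by auto
      have "L_value p m ((b, a') # (b, a) # map prod.swap h) = L_value p m (u # s # h)"
        using L_value_swap[of p m "u # s # h"] s u * by simp
      moreover have "(b, a') \<in> W" "xi p m (b, a') = xi p m u"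
        using wythoff_P_swap[of u] xi_swap[of u] trap(1) u * by auto
      moreover have "nim_move (b, a) (prod.swap t)"
        using assms(2) s nim_move_swap[of s t] by simp
      ultimately have "\<not> good (prod.swap t # (b, a) # map prod.swap h)"
        using not_good_after_trap[of b a' a "map prod.swap h" "prod.swap t"] trap(3) * by simp
      then show ?thesis using good_swap[of "t # s # h"] s by simp
    qed
  qed
qed

text \<open>
  The position \<open>(i, b)\<close> is a decoy: the opponent can enter the \<open>P\<close>-position of that row only by an
  imitation, which uses up one unit of his \<open>L\<close> and leaves less than \<open>\<xi>\<close>.  The two inequalities before
  the last premise say \<open>a - i \<le> b - (i + k) < a - i + m\<close>, the range of an imitation.
\<close>
lemma decoy_is_good:
  assumes "(i, i + k) \<in> W" "i < a" "a \<le> b" "i + k + a \<le> b + i" "b + i < i + k + a + m"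
    and "L_value p m ((a, b) # h) - 1 < int (xi p m (i, i + k))"
  shows "good ((i, b) # (a, b) # h)"
proof -
  have "leveling_move (i, b) (i, i + k)"
    using assms by auto
  moreover have "imitation m (a, b) (i, b) (i, i + k)"
    using assms by auto
  ultimately show ?thesis
    unfolding good_def using assms(1,6) by (intro disjI2 bexI[of _ "(i, i + k)"]) auto
qed

text \<open>
  If row \<open>a\<close> contains a \<open>P\<close>-position to the left, it can be moved to.  It is not poisoned if its height is at
  least \<open>a\<close>, as otherwise (II) would hold; and if its height is less than \<open>a\<close>, the distance from
  the main diagonal is at least \<open>m\<close>, too much for an imitation.  Otherwise one lowers the smaller
  pile as a decoy.  The target of the decoy is the preceding \<open>P\<close>-position of the diagonal if \<open>(a, b)\<close>
  is a poisoned \<open>P\<close>-position, and is provided by \<open>full_band\<close> if the row has no \<open>P\<close>-position.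
\<close>
lemma good_move_if_sorted:
  assumes "legal_play p m ((a, b) # h)" "a \<le> b" "\<not> good ((a, b) # h)"
  shows "\<exists>t. legal_play p m (t # (a, b) # h) \<and> good (t # (a, b) # h)"
proof -
  let ?L = "\<lambda>t. L_value p m (t # (a, b) # h)"
  have legal: "legal_play p m (t # (a, b) # h)" if "nim_move (a, b) t" "0 \<le> ?L t" for t
    using that assms(1) by (simp add: legal_play_Cons)
  have decoy: ?thesis
    if "(i, i + k) \<in> W" "i < a" "i + k + a \<le> b + i" "b + i < i + k + a + m"
      "L_value p m ((a, b) # h) - 1 < int (xi p m (i, i + k))" for i k
  proof -
    have "?L (i, b) = int p - 1"
      using no_imitation_on_smaller_pile[OF that(2) assms(2)] by (cases h) auto
    then show ?thesis
      using legal[of "(i, b)"] decoy_is_good[OF that(1,2) assms(2) that(3-5)] that(2) p_pos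
      by auto
  qed
  consider (here) "(a, b) \<in> W" | (row) c where "c < b" "(a, c) \<in> W" | (none) "\<forall>c\<le>b. (a, c) \<notin> W"
    by (metis le_neq_implies_less)
  then show ?thesis
  proof cases
    case here
    then have L_lt: "L_value p m ((a, b) # h) < int (xi p m (a, b))"
      using assms(3) by (auto simp: good_def)
    then have "xi p m (a, b) - 1 < xi p m (a, b)"
      using L_value_nonneg[OF assms(1)] by linarith
    then obtain i j where ij: "(i, j) \<in> W" "int j - int i = int b - int a" "i < a"
      "xi p m (i, j) = xi p m (a, b) - 1"
      by (rule xi_level)
    define k where "k = b - a"
    have "j = i + k" using ij(2) assms(2) k_def by linarith
    then show ?thesis
      using decoy[of i k] ij L_lt assms(2) k_def m_pos by simp
  next
    case row
    show ?thesis
    proof (cases "a \<le> c")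
      case True
      then have "int (xi p m (a, c)) \<le> ?L (a, c)"
        using row assms(3) unfolding good_def by fastforce
      then show ?thesis
        using legal[of "(a, c)"] row by (intro exI[of _ "(a, c)"]) (auto simp: good_def)
    next
      case False
      have "\<not> imitation m r (a, b) (a, c)" for r
      proof
        assume "imitation m r (a, b) (a, c)"
        then have "\<bar>int a - int c\<bar> < int m"
          using False assms(2) row(1) by (cases r) auto
        then show False
          using wythoff_P_near_main_diagonal[OF row(2)] False by simp
      qed
      then have "?L (a, c) = int p - 1"
        by (cases h) auto
      then show ?thesis
        using legal[of "(a, c)"] row xi_lt_p[OF row(2)]
        by (intro exI[of _ "(a, c)"]) (auto simp: good_def)
    qed
  next
    case none
    then have "\<forall>c\<le>a + (b - a). (a, c) \<notin> W" using assms(2) by simp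
    from full_band[OF this] obtain i k where ik: "(i, i + k) \<in> W" "i < a" "k \<le> b - a"
      "b - a < k + m" "xi p m (i, i + k) = p - 1" by blast
    then show ?thesis
      using decoy[of i k] assms(2) L_value_le[of p m "(a, b) # h"] p_pos by simp
  qed
qed

lemma good_move_if_not_good:
  assumes "legal_play p m (s # h)" "\<not> good (s # h)"
  shows "\<exists>t. legal_play p m (t # s # h) \<and> good (t # s # h)"
proof (cases "fst s \<le> snd s")
  case True
  then show ?thesis using good_move_if_sorted assms by (cases s) auto
next
  case False
  obtain a b where s: "s = (b, a)" by (cases s)
  have "legal_play p m ((a, b) # map prod.swap h)" "\<not> good ((a, b) # map prod.swap h)"
    using assms s legal_play_swap[of p m "s # h"] good_swap[of "s # h"] by auto
  then obtain t where t: "legal_play p m (t # (a, b) # map prod.swap h)"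
    "good (t # (a, b) # map prod.swap h)"
    using good_move_if_sorted[of a b "map prod.swap h"] False s by auto
  have "map prod.swap (prod.swap t # s # h) = t # (a, b) # map prod.swap h"
    using s by simp
  then show ?thesis
    using t legal_play_swap[of p m "prod.swap t # s # h"] good_swap[of "prod.swap t # s # h"]
    by (metis list.distinct(1))
qed

lemma imitation_nim_P_iff_good:
  assumes "legal_play p m H"
  shows "imitation_nim_P p m H \<longleftrightarrow> good H"
  unfolding imitation_nim_P_def
proof (rule prev_wins_iff_kernel[where Inv = "legal_play p m" and f = "\<lambda>H. fst (hd H) + snd (hd H)"])
  show "legal_play p m H" by fact
next
  fix H H' assume H: "legal_play p m H" and mv: "imitation_nim_move p m H H'"
  obtain s h where sh: "H = s # h" using H by (cases H) (auto simp: legal_play_def)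
  obtain t where t: "H' = t # H" "legal_play p m (t # H)"
    using mv by (auto simp: imitation_nim_move_def)
  then have nim: "nim_move s t" using sh by (simp add: legal_play_Cons)
  then show "legal_play p m H' \<and> fst (hd H') + snd (hd H') < fst (hd H) + snd (hd H)"
    using t sh by (cases s; cases t) auto
  show "\<not> good H'" if "good H"
    using not_good_after_good that nim t sh by blast
next
  fix H assume H: "legal_play p m H" "\<not> good H"
  obtain s h where "H = s # h" using H(1) by (cases H) (auto simp: legal_play_def)
  then show "\<exists>H'. imitation_nim_move p m H H' \<and> good H'"
    using good_move_if_not_good[of s h] H by (auto simp: imitation_nim_move_def)
qed

end

theorem theorem1:
  fixes p m a b :: nat and s :: position and h :: "position list"
  assumes "p \<ge> 1" and "m \<ge> 1" and "a \<le> b"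
    and "legal_play p m (s # h)"
    and "s = (a, b) \<or> s = (b, a)"
  shows "imitation_nim_P p m (s # h) \<longleftrightarrow>
    ((a, b) \<in> wythoff_P p m \<and>
       0 \<le> int (xi p m (a, b)) \<and> int (xi p m (a, b)) \<le> L_value p m (s # h)) \<or>
    (\<exists>c. a \<le> c \<and> c < b \<and> (a, c) \<in> wythoff_P p m \<and>
       (let t = (if s = (a, b) then (a, c) else (c, a)) in
          - 1 \<le> L_value p m (t # s # h) \<and>
          L_value p m (t # s # h) < int (xi p m (a, c)) \<and>
          int (xi p m (a, c)) \<le> int p - 1))"
proof -
  interpret pile_games p m
    using assms(1,2) by unfold_locales
  have swap: "(j, i) \<in> W \<longleftrightarrow> (i, j) \<in> W" "xi p m (j, i) = xi p m (i, j)" for i j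
    using wythoff_P_swap[of "(i, j)"] xi_swap[of "(i, j)"] by auto
  have L_ge: "- 1 \<le> L_value p m (t # s # h)" for t
  proof (cases h)
    case (Cons r h')
    have "legal_play p m h"
      using assms(4) Cons by (simp add: legal_play_Cons)
    then show ?thesis
      using Cons L_value_nonneg[of p m h] by simp
  qed simp
  have xi_le: "int (xi p m u) \<le> int p - 1" if "u \<in> W" for u
    using xi_lt_p[OF that] by linarith
  have here: "s \<in> W \<longleftrightarrow> (a, b) \<in> W" "xi p m s = xi p m (a, b)"
    using assms(5) swap by auto
  define \<tau> where "\<tau> = (\<lambda>c. if s = (a, b) then (a, c) else (c, a))"
  have tau: "\<tau> c \<in> W \<longleftrightarrow> (a, c) \<in> W" "xi p m (\<tau> c) = xi p m (a, c)" for c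
    using swap by (auto simp: \<tau>_def)
  have level: "leveling_move s t \<longleftrightarrow> (\<exists>c. a \<le> c \<and> c < b \<and> t = \<tau> c)" for t
  proof (cases "s = (a, b)")
    case True
    then have "\<tau> c = (a, c)" for c by (simp add: \<tau>_def)
    then show ?thesis
      using assms(3) unfolding True by (cases t) auto
  next
    case False
    then have "\<tau> c = (c, a)" for c by (simp add: \<tau>_def)
    moreover have "s = (b, a)" using False assms(5) by simp
    ultimately show ?thesis
      using assms(3) by (cases t) auto
  qed
  have "good (s # h) \<longleftrightarrow>
    ((a, b) \<in> W \<and> int (xi p m (a, b)) \<le> L_value p m (s # h)) \<or>
    (\<exists>c. a \<le> c \<and> c < b \<and> (a, c) \<in> W \<and> L_value p m (\<tau> c # s # h) < int (xi p m (a, c)))"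
    unfolding good_def list.sel here level using tau by auto
  moreover have "(if s = (a, b) then (a, c) else (c, a)) = \<tau> c" for c
    by (simp add: \<tau>_def)
  ultimately show ?thesis
    unfolding imitation_nim_P_iff_good[OF assms(4)] Let_def
    using L_ge xi_le by (simp only:) auto
qed

end
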